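(* Let $\mathsf{A}\in\mathbb{R}^{J_1\times I_1\times\cdots\times J_N\times I_N}$ be an even-order paired tensor. If $\operatorname{rank}_U(\mathsf{A})=\prod_{n=1}^N J_n$, then $\operatorname{rank}_{2n-1}(\mathsf{A})=J_n$ for $n=1,2,\dots,N$. Likewise, if $\operatorname{rank}_U(\mathsf{A})=\prod_{n=1}^N I_n$, then $\operatorname{rank}_{2n}(\mathsf{A})=I_n$ for $n=1,2,\dots,N$.
   Context: An even-order paired tensor is a $2N$-th order real tensor with entries written $\mathsf{A}_{j_1i_1\cdots j_Ni_N}$, $1\le j_n\le J_n$, $1\le i_n\le I_n$. Let $ivec(\mathbf{j},\mathcal{J})=j_1+\sum_{k=2}^N (j_k-1)\prod_{l=1}^{k-1}J_l$ for $\mathbf{j}=(j_1,\dots,j_N)$, $\mathcal{J}=(J_1,\dots,J_N)$ (similarly for $\mathcal{I}$). The unfolding $\varphi(\mathsf{A})$ is the $\prod_n J_n\times\prod_n I_n$ matrix whose entry in row $ivec(\mathbf{j},\mathcal{J})$ and column $ivec(\mathbf{i},\mathcal{I})$ is $\mathsf{A}_{j_1i_1\cdots j_Ni_N}$. The unfolding rank is $\operatorname{rank}_U(\mathsf{A})=\operatorname{rank}(\varphi(\mathsf{A}))$. For a tensor $\mathsf{X}$ of order $M$, the multilinear rank $\operatorname{rank}_m(\mathsf{X})$, $1\le m\le M$, is the rank of the $m$-mode matricization of $\mathsf{X}$, i.e. the matrix whose rows are indexed by the $m$-th index and whose columns are indexed by all the other indices jointly. *)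

theory Defs
  imports "Jordan_Normal_Form.DL_Rank" "HOL-Library.FuncSet"
begin

text \<open>
  A multi-index of order M is an extensional function on the positions 1, ..., M, and all
  indices count from 1. A real tensor of order M with dimensions D is a function on
  \<open>index_box M D\<close>; its values elsewhere play no role.
\<close>

type_synonym tensor = "(nat \<Rightarrow> nat) \<Rightarrow> real"

definition index_box :: "nat \<Rightarrow> (nat \<Rightarrow> nat) \<Rightarrow> (nat \<Rightarrow> nat) set" where
  "index_box M D = (\<Pi>\<^sub>E k\<in>{1..M}. {1..D k})"

text \<open>
  \<open>paired N j i\<close> is the sequence (j 1, i 1, ..., j N, i N). It is used both for
  multi-indices and for dimensions.
\<close>

definition paired :: "nat \<Rightarrow> (nat \<Rightarrow> nat) \<Rightarrow> (nat \<Rightarrow> nat) \<Rightarrow> nat \<Rightarrow> nat" where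
  "paired N j i = (\<lambda>k\<in>{1..2*N}. if odd k then j ((k + 1) div 2) else i (k div 2))"

definition ivec :: "nat \<Rightarrow> (nat \<Rightarrow> nat) \<Rightarrow> (nat \<Rightarrow> nat) \<Rightarrow> nat" where
  "ivec N j D = j 1 + (\<Sum>k=2..N. (j k - 1) * (\<Prod>l=1..k-1. D l))"

text \<open>
  Matrices are indexed from 0, so the row numbered r here is the row r + 1 in the
  counting of \<open>ivec\<close>; similarly for columns. The lemma \<open>unfold_mat_index\<close> below gives the
  entries without the description operator.
\<close>

definition unfold_mat :: "nat \<Rightarrow> (nat \<Rightarrow> nat) \<Rightarrow> (nat \<Rightarrow> nat) \<Rightarrow> tensor \<Rightarrow> real mat" where
  "unfold_mat N J I A = mat (\<Prod>n=1..N. J n) (\<Prod>n=1..N. I n)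
     (\<lambda>(r, c). A (paired N (THE j. j \<in> index_box N J \<and> ivec N j J = r + 1)
                           (THE i. i \<in> index_box N I \<and> ivec N i I = c + 1)))"

definition mat_rank :: "real mat \<Rightarrow> nat" where
  "mat_rank B = vec_space.rank (dim_row B) B"

definition rank_U :: "nat \<Rightarrow> (nat \<Rightarrow> nat) \<Rightarrow> (nat \<Rightarrow> nat) \<Rightarrow> tensor \<Rightarrow> nat" where
  "rank_U N J I A = mat_rank (unfold_mat N J I A)"

text \<open>
  The columns of the m-mode matricization are indexed by all indices except the m-th.
  They are enumerated here in the usual order, with the first remaining index varying
  fastest; the rank does not depend on this choice.
\<close>

definition mode_col :: "nat \<Rightarrow> (nat \<Rightarrow> nat) \<Rightarrow> nat \<Rightarrow> (nat \<Rightarrow> nat) \<Rightarrow> nat" where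
  "mode_col M D m x = 1 + (\<Sum>k\<in>{1..M} - {m}. (x k - 1) * (\<Prod>l\<in>{1..k-1} - {m}. D l))"

definition matricization :: "nat \<Rightarrow> (nat \<Rightarrow> nat) \<Rightarrow> nat \<Rightarrow> tensor \<Rightarrow> real mat" where
  "matricization M D m X = mat (D m) (\<Prod>k\<in>{1..M} - {m}. D k)
     (\<lambda>(r, c). X (THE x. x \<in> index_box M D \<and> x m = r + 1 \<and> mode_col M D m x = c + 1))"

definition multilinear_rank :: "nat \<Rightarrow> (nat \<Rightarrow> nat) \<Rightarrow> nat \<Rightarrow> tensor \<Rightarrow> nat" where
  "multilinear_rank M D m X = mat_rank (matricization M D m X)"

subsection \<open>Both enumerations are bijective\<close>

lemma mixed_radix_bij:
  fixes D :: "nat \<Rightarrow> nat"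
  assumes "finite K"
  shows "bij_betw (\<lambda>x. 1 + (\<Sum>k\<in>K. (x k - 1) * (\<Prod>l\<in>{l\<in>K. l < k}. D l)))
           (\<Pi>\<^sub>E k\<in>K. {1..D k}) {1..\<Prod>k\<in>K. D k}"
proof -
  define e where "e K x = (\<Sum>k\<in>K. (x k - 1) * (\<Prod>l\<in>{l\<in>K. l < k}. D l))"
    for K and x :: "nat \<Rightarrow> nat"
  have main: "(\<forall>x. (\<forall>k\<in>K. x k \<in> {1..D k}) \<longrightarrow> e K x < (\<Prod>k\<in>K. D k)) \<and>
      (\<forall>x y. (\<forall>k\<in>K. x k \<in> {1..D k}) \<longrightarrow> (\<forall>k\<in>K. y k \<in> {1..D k}) \<longrightarrow> e K x = e K y
         \<longrightarrow> (\<forall>k\<in>K. x k = y k))"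
    using assms
  proof (induction K rule: finite_linorder_max_induct)
    case empty
    then show ?case by (simp add: e_def)
  next
    case (insert b K)
    define P where "P = (\<Prod>k\<in>K. D k)"
    have bK: "b \<notin> K" using insert by auto
    have s1: "{l \<in> insert b K. l < b} = K" using insert by auto
    have s2: "{l \<in> insert b K. l < k} = {l \<in> K. l < k}" if "k \<in> K" for k
      using insert that by force
    have step: "e (insert b K) x = (x b - 1) * P + e K x" for x
      unfolding e_def P_def using bK insert(1) s1 s2 by simp
    have prod: "(\<Prod>k\<in>insert b K. D k) = D b * P"
      using bK insert(1) by (simp add: P_def)
    have lt: "e K x < P" if "\<forall>k\<in>insert b K. x k \<in> {1..D k}" for x
      using insert.IH that by (simp add: P_def)
    show ?case
    proof (intro conjI allI impI)
      fix x assume x: "\<forall>k\<in>insert b K. x k \<in> {1..D k}"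
      have "(x b - 1) * P + e K x < (x b - 1) * P + P" using lt[OF x] by simp
      also have "\<dots> = x b * P" using x by (cases "x b") auto
      also have "\<dots> \<le> D b * P" using x by simp
      finally show "e (insert b K) x < (\<Prod>k\<in>insert b K. D k)" by (simp add: step prod)
    next
      fix x y assume x: "\<forall>k\<in>insert b K. x k \<in> {1..D k}"
        and y: "\<forall>k\<in>insert b K. y k \<in> {1..D k}"
        and eq: "e (insert b K) x = e (insert b K) y"
      have eq': "(x b - 1) * P + e K x = (y b - 1) * P + e K y" using eq by (simp add: step)
      have "e K x = e K y"
        using arg_cong[OF eq', of "\<lambda>t. t mod P"] lt[OF x] lt[OF y] by simp
      moreover from this have "x b - 1 = y b - 1" using eq' lt[OF x] by simp
      moreover have "1 \<le> x b" "1 \<le> y b" using x y by simp_all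
      ultimately have "e K x = e K y" "x b = y b" by linarith+
      then show "\<forall>k\<in>insert b K. x k = y k" using insert.IH x y by blast
    qed
  qed
  let ?f = "\<lambda>x. 1 + e K x" and ?B = "\<Pi>\<^sub>E k\<in>K. {1..D k}"
  have inj: "inj_on ?f ?B"
  proof (rule inj_onI)
    fix x y assume "x \<in> ?B" "y \<in> ?B" "?f x = ?f y"
    moreover from this have "\<forall>k\<in>K. x k = y k"
      using main by (simp add: PiE_iff)
    ultimately show "x = y" by (intro PiE_ext) auto
  qed
  have "?f ` ?B \<subseteq> {1..\<Prod>k\<in>K. D k}"
  proof clarify
    fix x assume "x \<in> ?B"
    then have "e K x < (\<Prod>k\<in>K. D k)" using main by (simp add: PiE_iff)
    then show "?f x \<in> {1..\<Prod>k\<in>K. D k}" by simp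
  qed
  moreover have "card (?f ` ?B) = card {1..\<Prod>k\<in>K. D k}"
    using assms by (subst card_image[OF inj]) (simp add: card_PiE)
  ultimately have "?f ` ?B = {1..\<Prod>k\<in>K. D k}"
    by (intro card_subset_eq) auto
  then show ?thesis using inj by (simp add: bij_betw_def e_def)
qed

lemma ivec_bij:
  assumes "N \<ge> 1"
  shows "bij_betw (\<lambda>j. ivec N j D) (index_box N D) {1..\<Prod>n=1..N. D n}"
proof -
  have eq: "ivec N j D = 1 + (\<Sum>k\<in>{1..N}. (j k - 1) * (\<Prod>l\<in>{l\<in>{1..N}. l < k}. D l))"
    if "j \<in> index_box N D" for j
  proof -
    have s: "{l\<in>{1..N}. l < k} = {1..k-1}" if "k \<in> {1..N}" for k
      using that by auto
    have "(\<Sum>k\<in>{1..N}. (j k - 1) * (\<Prod>l\<in>{l\<in>{1..N}. l < k}. D l))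
        = (\<Sum>k\<in>{1..N}. (j k - 1) * (\<Prod>l=1..k-1. D l))"
      by (intro sum.cong refl) (simp only: s)
    also have "\<dots> = (j 1 - 1) + (\<Sum>k=2..N. (j k - 1) * (\<Prod>l=1..k-1. D l))"
      by (subst sum.atLeast_Suc_atMost[OF assms]) (simp add: numeral_2_eq_2)
    finally have *: "(\<Sum>k\<in>{1..N}. (j k - 1) * (\<Prod>l\<in>{l\<in>{1..N}. l < k}. D l))
      = (j 1 - 1) + (\<Sum>k=2..N. (j k - 1) * (\<Prod>l=1..k-1. D l))" .
    have "j 1 \<in> {1..D 1}" using that assms by (simp add: index_box_def PiE_iff)
    then show ?thesis unfolding ivec_def * by auto
  qed
  show ?thesis
    by (rule iffD2[OF bij_betw_cong[OF eq] mixed_radix_bij[of "{1..N}" D, folded index_box_def]])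
      simp_all
qed

lemma mode_bij:
  assumes "m \<in> {1..M}"
  shows "bij_betw (\<lambda>x. (x m, mode_col M D m x)) (index_box M D)
           ({1..D m} \<times> {1..\<Prod>k\<in>{1..M} - {m}. D k})"
proof -
  let ?K = "{1..M} - {m}"
  let ?g = "\<lambda>x. 1 + (\<Sum>k\<in>?K. (x k - 1) * (\<Prod>l\<in>{l\<in>?K. l < k}. D l))"
  have s: "{l\<in>?K. l < k} = {1..k-1} - {m}" if "k \<in> ?K" for k
    using that by auto
  have g: "mode_col M D m x = ?g x" for x
    unfolding mode_col_def by (intro arg_cong2[of _ _ _ _ "(+)"] sum.cong refl) (simp only: s)
  have gr: "?g (restrict x ?K) = ?g x" for x
    by (intro arg_cong2[of _ _ _ _ "(+)"] sum.cong refl) simp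
  have bij: "bij_betw ?g (\<Pi>\<^sub>E k\<in>?K. {1..D k}) {1..\<Prod>k\<in>?K. D k}"
    by (rule mixed_radix_bij) simp
  have res: "restrict x ?K \<in> (\<Pi>\<^sub>E k\<in>?K. {1..D k})" if "x \<in> index_box M D" for x
    using that by (auto simp: index_box_def PiE_iff)
  have inj: "inj_on (\<lambda>x. (x m, mode_col M D m x)) (index_box M D)"
  proof (rule inj_onI)
    fix x y assume x: "x \<in> index_box M D" and y: "y \<in> index_box M D"
      and eq: "(x m, mode_col M D m x) = (y m, mode_col M D m y)"
    then have "?g (restrict x ?K) = ?g (restrict y ?K)" by (simp only: gr g prod.inject)
    then have r: "restrict x ?K = restrict y ?K"
      by (rule inj_onD[OF bij_betw_imp_inj_on[OF bij] _ res[OF x] res[OF y]])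
    have "x k = y k" if "k \<in> {1..M}" for k
      using fun_cong[OF r, of k] eq that by (cases "k = m") (auto simp: restrict_def)
    then show "x = y" using x y unfolding index_box_def by (intro PiE_ext) auto
  qed
  have sub: "(\<lambda>x. (x m, mode_col M D m x)) ` index_box M D
      \<subseteq> {1..D m} \<times> {1..\<Prod>k\<in>?K. D k}"
  proof clarify
    fix x assume x: "x \<in> index_box M D"
    have "x m \<in> {1..D m}" using x assms by (auto simp: index_box_def PiE_iff)
    moreover have "?g (restrict x ?K) \<in> {1..\<Prod>k\<in>?K. D k}"
      using bij_betwE[OF bij] res[OF x] by blast
    ultimately show "x m \<in> {1..D m} \<and> mode_col M D m x \<in> {1..\<Prod>k\<in>?K. D k}"
      unfolding gr g by simp
  qed
  have "card ((\<lambda>x. (x m, mode_col M D m x)) ` index_box M D)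
      = card ({1..D m} \<times> {1..\<Prod>k\<in>?K. D k})"
    using prod.remove[OF _ assms, of D] by (subst card_image[OF inj])
      (simp add: index_box_def card_PiE card_cartesian_product)
  from card_subset_eq[OF _ sub this]
  have "(\<lambda>x. (x m, mode_col M D m x)) ` index_box M D
      = {1..D m} \<times> {1..\<Prod>k\<in>?K. D k}"
    by blast
  then show ?thesis using inj by (simp add: bij_betw_def)
qed

lemma unfold_mat_index:
  assumes "N \<ge> 1" "j \<in> index_box N J" "i \<in> index_box N I"
  shows "unfold_mat N J I A $$ (ivec N j J - 1, ivec N i I - 1) = A (paired N j i)"
proof -
  have ran: "ivec N x D \<in> {1..\<Prod>n=1..N. D n}" if "x \<in> index_box N D" for x D
    using bij_betwE[OF ivec_bij[OF assms(1)]] that by blast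
  have the: "(THE y. y \<in> index_box N D \<and> ivec N y D = ivec N x D) = x" if "x \<in> index_box N D" for x D
    using that bij_betw_imp_inj_on[OF ivec_bij[OF assms(1)], of D]
    by (intro the_equality) (auto dest: inj_onD)
  have "ivec N j J - 1 < (\<Prod>n=1..N. J n)" "ivec N j J - 1 + 1 = ivec N j J"
    "ivec N i I - 1 < (\<Prod>n=1..N. I n)" "ivec N i I - 1 + 1 = ivec N i I"
    using ran[OF assms(2)] ran[OF assms(3)] by auto
  then show ?thesis
    unfolding unfold_mat_def
    by (simp only: index_mat(1) prod.case the[OF assms(2)] the[OF assms(3)])
qed

lemma matricization_index:
  assumes "m \<in> {1..M}" "x \<in> index_box M D"
  shows "matricization M D m X $$ (x m - 1, mode_col M D m x - 1) = X x"
proof -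
  have ran: "(x m, mode_col M D m x) \<in> {1..D m} \<times> {1..\<Prod>k\<in>{1..M} - {m}. D k}"
    by (rule bspec[OF bij_betwE[OF mode_bij[OF assms(1)]] assms(2)])
  have the: "(THE y. y \<in> index_box M D \<and> y m = x m \<and> mode_col M D m y = mode_col M D m x) = x"
    using assms(2) inj_onD[OF bij_betw_imp_inj_on[OF mode_bij[OF assms(1)], of D]]
    by (intro the_equality) auto
  have "x m - 1 < D m" "x m - 1 + 1 = x m"
    "mode_col M D m x - 1 < (\<Prod>k\<in>{1..M} - {m}. D k)"
    "mode_col M D m x - 1 + 1 = mode_col M D m x"
    using ran by auto
  then show ?thesis
    unfolding matricization_def by (simp only: index_mat(1) prod.case the)
qed

end

theory Submission
  imports Defs
begin

text \<open>
  A matrix has full row rank iff its transpose has trivial kernel. A vector in the kernel of the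
  transposed mode matricization extends by zero, along the rows of the unfolding whose remaining
  row indices are all 1, to a vector in the kernel of the transposed unfolding. For the even
  modes, the same argument is applied to the transpose of the unfolding.
\<close>

section \<open>Full rank of real matrices in terms of kernels\<close>

lemma (in vec_space) rank_indpt_colsE:
  assumes "B \<in> carrier_mat n c"
  obtains S where "S \<subseteq> set (cols B)" "lin_indpt S" "card S = rank B"
proof -
  \<comment> \<open>Every maximal independent set of columns has cardinality \<open>rank B\<close>,
    and one exists above the empty set because there are finitely many columns.\<close>
  define P where "P = (\<lambda>T. T \<subseteq> set (cols B) \<and> lin_indpt T)"
  have "P {}" using finite_lin_indpt2[of "{}"] by (simp add: P_def)
  then obtain S where "maximal S P"
    using maximal_exists_superset[of "set (cols B)" P "{}"] by (auto simp: P_def)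
  then show thesis
    using that[of S] rank_card_indpt[OF assms] by (auto simp: maximal_def P_def)
qed

text \<open>Choosing \<open>m\<close> independent columns of \<open>B\<close> gives an invertible
  square matrix \<open>C\<close>. The entries of \<open>C\<^sup>T *\<^sub>v v\<close> occur among
  those of \<open>B\<^sup>T *\<^sub>v v\<close>, so they vanish and \<open>v\<close> is
  zero.\<close>

lemma full_row_rank_transpose_kernel:
  assumes B: "B \<in> carrier_mat m c" and rank: "mat_rank B = m"
    and v: "v \<in> carrier_vec m" and zero: "B\<^sup>T *\<^sub>v v = 0\<^sub>v c"
  shows "v = 0\<^sub>v m"
proof -
  interpret vec_space "TYPE(real)" m .
  have "rank B = m" using rank B by (simp add: mat_rank_def)
  then obtain S where "S \<subseteq> set (cols B)" "lin_indpt S" "card S = m"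
    using rank_indpt_colsE[OF B] by metis
  then obtain ws where ws: "set ws = S" "distinct ws" "length ws = m"
    using finite_distinct_list[of S] by (metis List.finite_set distinct_card finite_subset)
  have sub: "set ws \<subseteq> carrier_vec m"
    using ws \<open>S \<subseteq> _\<close> cols_dim[of B] B by auto
  define C where "C = mat_of_cols m ws"
  have C: "C \<in> carrier_mat m m" using ws by (auto simp: C_def)
  have cols: "cols C = ws" using sub by (simp add: C_def)
  have "rank C = m"
    using lin_indpt_full_rank[OF C] ws \<open>lin_indpt S\<close> by (simp add: cols)
  then have "det C\<^sup>T \<noteq> 0"
    using det_rank_iff[OF C] det_transpose[OF C] by simp
  moreover have "C\<^sup>T *\<^sub>v v = 0\<^sub>v m"
  proof (rule eq_vecI)
    fix k assume "k < dim_vec (0\<^sub>v m :: real vec)"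
    then have k: "k < m" by simp
    then have "ws ! k \<in> set (cols B)" using ws \<open>S \<subseteq> _\<close> by (metis nth_mem subsetD)
    then obtain q where q: "q < c" "ws ! k = col B q"
      using B by (metis carrier_matD(2) cols_length cols_nth in_set_conv_nth)
    have "col B q \<bullet> v = (B\<^sup>T *\<^sub>v v) $ q" using q B by simp
    moreover have "(C\<^sup>T *\<^sub>v v) $ k = col C k \<bullet> v" using k C by simp
    moreover have "col C k = ws ! k" using k C cols by (metis carrier_matD(2) cols_nth)
    ultimately show "(C\<^sup>T *\<^sub>v v) $ k = 0\<^sub>v m $ k" using zero q k by simp
  qed (use C in auto)
  ultimately show ?thesis
    using det_0_iff_vec_prod_zero_field[of "C\<^sup>T" m] C v by auto
qed

lemma full_row_rankI:
  assumes B: "B \<in> carrier_mat m c"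
    and inj: "\<And>v. v \<in> carrier_vec m \<Longrightarrow> B\<^sup>T *\<^sub>v v = 0\<^sub>v c \<Longrightarrow> v = 0\<^sub>v m"
  shows "mat_rank B = m"
proof -
  interpret vec_space "TYPE(real)" m .
  have Bt: "B\<^sup>T \<in> carrier_mat c m" and G: "B * B\<^sup>T \<in> carrier_mat m m"
    using B by auto
  \<comment> \<open>The Gram matrix is invertible, since \<open>v \<bullet> (B * B\<^sup>T) v\<close> is the squared length of \<open>B\<^sup>T v\<close>.\<close>
  have "det (B * B\<^sup>T) \<noteq> 0"
  proof
    assume "det (B * B\<^sup>T) = 0"
    then obtain v where v: "v \<in> carrier_vec m" "v \<noteq> 0\<^sub>v m" "B * B\<^sup>T *\<^sub>v v = 0\<^sub>v m"
      using det_0_iff_vec_prod_zero_field[OF G] by blast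
    have w: "B\<^sup>T *\<^sub>v v \<in> carrier_vec c" using Bt v by auto
    have "(B\<^sup>T *\<^sub>v v) \<bullet> (B\<^sup>T *\<^sub>v v) = v \<bullet> (B *\<^sub>v (B\<^sup>T *\<^sub>v v))"
      by (rule transpose_vec_mult_scalar[OF B w v(1)])
    also have "B *\<^sub>v (B\<^sup>T *\<^sub>v v) = B * B\<^sup>T *\<^sub>v v"
      by (rule assoc_mult_mat_vec[OF B Bt v(1), symmetric])
    finally have "(B\<^sup>T *\<^sub>v v) \<bullet> (B\<^sup>T *\<^sub>v v) = 0" using v by simp
    then have "B\<^sup>T *\<^sub>v v = 0\<^sub>v c" using conjugate_square_eq_0_vec[OF w] by simp
    then show False using inj v by blast
  qed
  then obtain H where H: "H \<in> carrier_mat m m" "B * B\<^sup>T * H = 1\<^sub>m m"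
    using det_non_zero_imp_unit[OF G] unfolding Units_def ring_mat_simps by blast
  \<comment> \<open>\<open>B\<^sup>T * H\<close> is a right inverse of \<open>B\<close>, so the
    columns of \<open>B\<close> span the whole space.\<close>
  have "\<exists>x\<in>carrier_vec c. B *\<^sub>v x = y" if y: "y \<in> carrier_vec m" for y
  proof
    show "B\<^sup>T *\<^sub>v (H *\<^sub>v y) \<in> carrier_vec c" using Bt H y by auto
    have Hy: "H *\<^sub>v y \<in> carrier_vec m" using H y by auto
    have "B *\<^sub>v (B\<^sup>T *\<^sub>v (H *\<^sub>v y)) = B * B\<^sup>T *\<^sub>v (H *\<^sub>v y)"
      by (rule assoc_mult_mat_vec[OF B Bt Hy, symmetric])
    also have "\<dots> = B * B\<^sup>T * H *\<^sub>v y"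
      by (rule assoc_mult_mat_vec[OF G H(1) y, symmetric])
    finally show "B *\<^sub>v (B\<^sup>T *\<^sub>v (H *\<^sub>v y)) = y" using H(2) y by simp
  qed
  then have "col_space B = carrier_vec m"
    using col_space_eq[OF B] B by auto
  then have "span (set (cols B)) = carrier_vec m" by (simp add: col_space_def)
  \<comment> \<open>\<open>rank\<close> is the dimension of \<open>V\<close> with its carrier
    replaced by the column span. As that span is everything, the replacement gives back
    \<open>V\<close> itself.\<close>
  moreover have "V\<lparr>carrier := carrier_vec m\<rparr> = V"
    unfolding module_vec_def by (rule partial_object.update_convs)
  ultimately have "rank B = dim" by (simp only: rank_def)
  then show ?thesis using B dim_is_n by (simp add: mat_rank_def)
qed

text \<open>Serves the even modes: there the unfolding is transposed, so the kernel that must be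
  trivial is that of the unfolding itself.\<close>

lemma full_col_rank_kernel:
  assumes B: "B \<in> carrier_mat m c" and rank: "mat_rank B = c"
    and v: "v \<in> carrier_vec c" and zero: "B *\<^sub>v v = 0\<^sub>v m"
  shows "v = 0\<^sub>v c"
proof -
  interpret vec_space "TYPE(real)" m .
  have r: "rank B = c" using rank B by (simp add: mat_rank_def)
  \<comment> \<open>Independence is a property of the set of columns, which would hide a repeated
    column. A repetition would leave fewer than \<open>c\<close> distinct columns, too few for rank
    \<open>c\<close>.\<close>
  have dist: "distinct (cols B)"
  proof -
    obtain S where S: "S \<subseteq> set (cols B)" "card S = rank B"
      using rank_indpt_colsE[OF B] by metis
    have "card S \<le> card (set (cols B))" by (intro card_mono S(1)) simp
    then show ?thesis
      using S(2) r B card_length[of "cols B"] by (intro card_distinct) simp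
  qed
  then have "lin_indpt (set (cols B))" by (rule full_rank_lin_indpt[OF B r])
  then show ?thesis using lin_depI[OF B v _ zero dist] by blast
qed

section \<open>From a trivial kernel to full multilinear rank\<close>

text \<open>\<open>B\<close> stands for the unfolding or its transpose. The rows \<open>f r\<close>
  are those where only the index of mode \<open>m\<close> varies; \<open>P c\<close> holds the other
  indices, its slot \<open>m\<close> being overwritten. Each column of \<open>B\<close>, restricted
  to these rows, is a column of the matricization, so zero extension along \<open>f\<close>
  preserves kernel vectors.\<close>

lemma multilinear_rank_fullI:
  assumes m: "m \<in> {1..M}" and B: "B \<in> carrier_mat p q"
    and ker: "\<And>v. v \<in> carrier_vec p \<Longrightarrow> B\<^sup>T *\<^sub>v v = 0\<^sub>v q \<Longrightarrow> v = 0\<^sub>v p"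
    and inj: "inj_on f {..<D m}" and ran: "\<And>r. r < D m \<Longrightarrow> f r < p"
    and box: "\<And>r c. r < D m \<Longrightarrow> c < q \<Longrightarrow> (P c)(m := r + 1) \<in> index_box M D"
    and entry: "\<And>r c. r < D m \<Longrightarrow> c < q \<Longrightarrow> B $$ (f r, c) = A ((P c)(m := r + 1))"
  shows "multilinear_rank M D m A = D m"
  unfolding multilinear_rank_def
proof (rule full_row_rankI)
  define w where "w = (\<Prod>k\<in>{1..M} - {m}. D k)"
  let ?R = "matricization M D m A"
  show R: "?R \<in> carrier_mat (D m) w" by (simp add: matricization_def w_def)
  fix y assume y: "y \<in> carrier_vec (D m)" and zero: "?R\<^sup>T *\<^sub>v y = 0\<^sub>v w"
  \<comment> \<open>The 0-based column of the matricization met by column \<open>c\<close> of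
    \<open>B\<close>; it does not depend on slot \<open>m\<close>.\<close>
  define g where "g c = mode_col M D m (P c) - 1" for c
  have col: "mode_col M D m ((P c)(m := t)) = mode_col M D m (P c)" for c t
    unfolding mode_col_def by (intro arg_cong2[of _ _ _ _ "(+)"] sum.cong refl) auto
  have g: "g c < w" if "r < D m" "c < q" for r c
    using bij_betwE[OF mode_bij[OF m, of D]] box[OF that]
    by (fastforce simp: g_def w_def col)
  have Rg: "?R $$ (r, g c) = B $$ (f r, c)" if "r < D m" "c < q" for r c
    using matricization_index[OF m box[OF that], of A] entry[OF that] by (simp add: g_def col)
  define v where "v = vec p (\<lambda>k. if k \<in> f ` {..<D m} then y $ inv_into {..<D m} f k else 0)"
  have vf: "v $ f r = y $ r" if "r < D m" for r
    using that ran inj by (simp add: v_def)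
  have "B\<^sup>T *\<^sub>v v = 0\<^sub>v q"
  proof (rule eq_vecI)
    fix c assume "c < dim_vec (0\<^sub>v q :: real vec)"
    then have c: "c < q" by simp
    have "(B\<^sup>T *\<^sub>v v) $ c = (\<Sum>k<p. B $$ (k, c) * v $ k)"
      using B c by (simp add: scalar_prod_def v_def atLeast0LessThan)
    also have "\<dots> = (\<Sum>k\<in>f ` {..<D m}. B $$ (k, c) * v $ k)"
      using ran by (intro sum.mono_neutral_right) (auto simp: v_def)
    also have "\<dots> = (\<Sum>r<D m. ?R $$ (r, g c) * y $ r)"
      using c by (simp add: sum.reindex[OF inj] vf Rg)
    also have "\<dots> = 0"
    \<comment> \<open>The bound on \<open>g c\<close> comes from a multi-index in the box, hence
      from some \<open>r < D m\<close>. If there is none, the sum is empty.\<close>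
    proof (cases "D m = 0")
      case False
      then have gc: "g c < w" using g c by blast
      then have "(\<Sum>r<D m. ?R $$ (r, g c) * y $ r) = (?R\<^sup>T *\<^sub>v y) $ g c"
        using R y by (simp add: scalar_prod_def atLeast0LessThan)
      then show ?thesis using zero gc by simp
    qed simp
    finally show "(B\<^sup>T *\<^sub>v v) $ c = 0\<^sub>v q $ c" using c by simp
  qed (use B in auto)
  then have "v = 0\<^sub>v p" by (intro ker) (simp add: v_def)
  then have "y $ r = 0" if "r < D m" for r
    using vf[OF that] ran[OF that] by simp
  then show "y = 0\<^sub>v (D m)"
    using y by (intro eq_vecI) auto
qed

section \<open>Varying one entry of a multi-index, and paired multi-indices\<close>

lemma index_box_upd:
  assumes "x \<in> index_box N D" "n \<in> {1..N}" "r < D n"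
  shows "x(n := r + 1) \<in> index_box N D"
  using assms by (auto simp: index_box_def PiE_iff extensional_def)

lemma ivec_upd_inj:
  assumes x: "x \<in> index_box N D" and n: "n \<in> {1..N}"
  shows "inj_on (\<lambda>r. ivec N (x(n := r + 1)) D - 1) {..<D n}"
proof (rule inj_onI)
  fix r s assume rs: "r \<in> {..<D n}" "s \<in> {..<D n}"
    and eq: "ivec N (x(n := r + 1)) D - 1 = ivec N (x(n := s + 1)) D - 1"
  have N: "N \<ge> 1" using n by simp
  have box: "x(n := t + 1) \<in> index_box N D" if "t \<in> {..<D n}" for t
    using index_box_upd[OF x n] that by simp
  \<comment> \<open>Natural subtraction of 1 can be cancelled only for positive values.\<close>
  have "ivec N (x(n := t + 1)) D \<ge> 1" if "t \<in> {..<D n}" for t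
    using bij_betwE[OF ivec_bij[OF N]] box[OF that] by fastforce
  then have "ivec N (x(n := r + 1)) D = ivec N (x(n := s + 1)) D"
    using eq rs by (metis le_add_diff_inverse)
  then have "x(n := r + 1) = x(n := s + 1)"
    using inj_onD[OF bij_betw_imp_inj_on[OF ivec_bij[OF N]]] box rs by blast
  then show "r = s" by (metis add_right_cancel fun_upd_same)
qed

lemma ivec_less:
  assumes "N \<ge> 1" "x \<in> index_box N D"
  shows "ivec N x D - 1 < (\<Prod>n=1..N. D n)"
  using bij_betwE[OF ivec_bij[OF assms(1)]] assms(2) by fastforce

lemma ivec_surj:
  assumes "N \<ge> 1" "c < (\<Prod>n=1..N. D n)"
  shows "\<exists>x\<in>index_box N D. ivec N x D - 1 = c"
proof -
  have "c + 1 \<in> (\<lambda>x. ivec N x D) ` index_box N D"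
    using bij_betw_imp_surj_on[OF ivec_bij[OF assms(1)], of D] assms(2) by simp
  then show ?thesis by force
qed

lemma paired_odd: "n \<in> {1..N} \<Longrightarrow> paired N j i (2 * n - 1) = j n"
  and paired_even: "n \<in> {1..N} \<Longrightarrow> paired N j i (2 * n) = i n"
  by (auto simp: paired_def)

text \<open>Turns a change of one row index into the overwriting of a single slot, the form that
  \<open>multilinear_rank_fullI\<close> expects.\<close>

lemma paired_upd_odd:
  assumes "n \<in> {1..N}"
  shows "paired N (j(n := t)) i = (paired N j i)(2 * n - 1 := t)"
proof
  fix k
  show "paired N (j(n := t)) i k = ((paired N j i)(2 * n - 1 := t)) k"
    using assms by (cases "odd k") (auto simp: paired_def elim!: oddE)
qed

lemma paired_upd_even:
  assumes "n \<in> {1..N}"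
  shows "paired N j (i(n := t)) = (paired N j i)(2 * n := t)"
proof
  fix k
  show "paired N j (i(n := t)) k = ((paired N j i)(2 * n := t)) k"
    using assms by (cases "odd k") (auto simp: paired_def elim!: oddE evenE)
qed

lemma paired_box:
  assumes "j \<in> index_box N J" "i \<in> index_box N I"
  shows "paired N j i \<in> index_box (2 * N) (paired N J I)"
proof -
  have "paired N j i k \<in> {1..paired N J I k}" if k: "k \<in> {1..2 * N}" for k
  proof (cases "odd k")
    case True
    then obtain n where "k = 2 * n + 1" by (rule oddE)
    then have "n + 1 \<in> {1..N}" "paired N j i k = j (n + 1)" "paired N J I k = J (n + 1)"
      using k by (auto simp: paired_def)
    then show ?thesis using assms(1) by (auto simp: index_box_def PiE_iff)
  next
    case False
    then obtain n where "k = 2 * n" by auto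
    then have "n \<in> {1..N}" "paired N j i k = i n" "paired N J I k = I n"
      using k by (auto simp: paired_def)
    then show ?thesis using assms(2) by (auto simp: index_box_def PiE_iff)
  qed
  then show ?thesis by (auto simp: index_box_def PiE_iff paired_def)
qed

text \<open>Positivity of the dimensions enters here: it supplies the base multi-index whose
  \<open>n\<close>-th entry is then varied.\<close>

lemma ones_in_box:
  assumes "\<forall>n\<in>{1..N}. 1 \<le> D n"
  shows "(\<lambda>n\<in>{1..N}. 1) \<in> index_box N D"
  using assms by (auto simp: index_box_def)

section \<open>The odd and the even modes\<close>

lemma rank_U_odd_mode:
  assumes J: "\<forall>n\<in>{1..N}. 1 \<le> J n" and n: "n \<in> {1..N}"
    and rank: "rank_U N J I A = (\<Prod>n=1..N. J n)"
  shows "multilinear_rank (2 * N) (paired N J I) (2 * n - 1) A = J n"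
proof -
  have N: "N \<ge> 1" using n by simp
  let ?p = "\<Prod>n=1..N. J n" and ?q = "\<Prod>n=1..N. I n"
  define j0 :: "nat \<Rightarrow> nat" where "j0 = (\<lambda>n\<in>{1..N}. 1)"
  have j0: "j0 \<in> index_box N J" using ones_in_box[OF J] by (simp add: j0_def)
  define f where "f r = ivec N (j0(n := r + 1)) J - 1" for r
  \<comment> \<open>\<open>i c\<close> decodes the 0-based column number \<open>c\<close> into its
    multi-index.\<close>
  obtain i where i: "i c \<in> index_box N I" "ivec N (i c) I - 1 = c" if "c < ?q" for c
    using ivec_surj[OF N, of _ I] by metis
  have Dm: "paired N J I (2 * n - 1) = J n" by (rule paired_odd[OF n])
  have B: "unfold_mat N J I A \<in> carrier_mat ?p ?q" by (simp add: unfold_mat_def)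
  have "multilinear_rank (2 * N) (paired N J I) (2 * n - 1) A = paired N J I (2 * n - 1)"
  proof (rule multilinear_rank_fullI[OF _ B, where f = f and P = "\<lambda>c. paired N j0 (i c)"],
      unfold Dm)
    show "2 * n - 1 \<in> {1..2 * N}" using n by auto
    show "v = 0\<^sub>v ?p" if "v \<in> carrier_vec ?p" "(unfold_mat N J I A)\<^sup>T *\<^sub>v v = 0\<^sub>v ?q" for v
      by (rule full_row_rank_transpose_kernel[OF B rank[unfolded rank_U_def] that])
    show "inj_on f {..<J n}" unfolding f_def by (rule ivec_upd_inj[OF j0 n])
  next
    fix r assume r: "r < J n"
    have box: "j0(n := r + 1) \<in> index_box N J" by (rule index_box_upd[OF j0 n r])
    then show "f r < ?p" unfolding f_def by (rule ivec_less[OF N])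
    fix c assume c: "c < ?q"
    show "(paired N j0 (i c))(2 * n - 1 := r + 1) \<in> index_box (2 * N) (paired N J I)"
      using paired_box[OF box i(1)[OF c]] by (simp only: paired_upd_odd[OF n])
    show "unfold_mat N J I A $$ (f r, c) = A ((paired N j0 (i c))(2 * n - 1 := r + 1))"
      using unfold_mat_index[OF N box i(1)[OF c], of A]
      by (simp only: f_def i(2)[OF c] paired_upd_odd[OF n])
  qed
  then show ?thesis by (simp only: Dm)
qed

lemma rank_U_even_mode:
  assumes I: "\<forall>n\<in>{1..N}. 1 \<le> I n" and n: "n \<in> {1..N}"
    and rank: "rank_U N J I A = (\<Prod>n=1..N. I n)"
  shows "multilinear_rank (2 * N) (paired N J I) (2 * n) A = I n"
proof -
  have N: "N \<ge> 1" using n by simp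
  let ?p = "\<Prod>n=1..N. J n" and ?q = "\<Prod>n=1..N. I n"
  define i0 :: "nat \<Rightarrow> nat" where "i0 = (\<lambda>n\<in>{1..N}. 1)"
  have i0: "i0 \<in> index_box N I" using ones_in_box[OF I] by (simp add: i0_def)
  define f where "f r = ivec N (i0(n := r + 1)) I - 1" for r
  obtain j where j: "j c \<in> index_box N J" "ivec N (j c) J - 1 = c" if "c < ?p" for c
    using ivec_surj[OF N, of _ J] by metis
  have Dm: "paired N J I (2 * n) = I n" by (rule paired_even[OF n])
  have B: "unfold_mat N J I A \<in> carrier_mat ?p ?q" by (simp add: unfold_mat_def)
  have Bt: "(unfold_mat N J I A)\<^sup>T \<in> carrier_mat ?q ?p" using B by simp
  have "multilinear_rank (2 * N) (paired N J I) (2 * n) A = paired N J I (2 * n)"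
  proof (rule multilinear_rank_fullI[OF _ Bt, where f = f and P = "\<lambda>c. paired N (j c) i0"],
      unfold Dm)
    show "2 * n \<in> {1..2 * N}" using n by auto
    \<comment> \<open>The rank hypothesis concerns the unfolding, not its transpose; cancelling the
      double transpose reduces the claim to independence of the columns.\<close>
    show "v = 0\<^sub>v ?q" if "v \<in> carrier_vec ?q" "(unfold_mat N J I A)\<^sup>T\<^sup>T *\<^sub>v v = 0\<^sub>v ?p" for v
      using full_col_rank_kernel[OF B rank[unfolded rank_U_def] that(1)] that(2)
      by (simp only: transpose_transpose)
    show "inj_on f {..<I n}" unfolding f_def by (rule ivec_upd_inj[OF i0 n])
  next
    fix r assume r: "r < I n"
    have box: "i0(n := r + 1) \<in> index_box N I" by (rule index_box_upd[OF i0 n r])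
    then show f: "f r < ?q" unfolding f_def by (rule ivec_less[OF N])
    fix c assume c: "c < ?p"
    show "(paired N (j c) i0)(2 * n := r + 1) \<in> index_box (2 * N) (paired N J I)"
      using paired_box[OF j(1)[OF c] box] by (simp only: paired_upd_even[OF n])
    have "(unfold_mat N J I A)\<^sup>T $$ (f r, c) = unfold_mat N J I A $$ (c, f r)"
      using B c f by auto
    then show "(unfold_mat N J I A)\<^sup>T $$ (f r, c) = A ((paired N (j c) i0)(2 * n := r + 1))"
      using unfold_mat_index[OF N j(1)[OF c] box, of A]
      by (simp only: f_def j(2)[OF c] paired_upd_even[OF n])
  qed
  then show ?thesis by (simp only: Dm)
qed

theorem proposition4p6:
  fixes N :: nat and J I :: "nat \<Rightarrow> nat" and A :: tensor
  assumes "\<forall>n\<in>{1..N}. 1 \<le> J n" and "\<forall>n\<in>{1..N}. 1 \<le> I n"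
  shows "(rank_U N J I A = (\<Prod>n=1..N. J n) \<longrightarrow>
            (\<forall>n\<in>{1..N}. multilinear_rank (2 * N) (paired N J I) (2 * n - 1) A = J n)) \<and>
         (rank_U N J I A = (\<Prod>n=1..N. I n) \<longrightarrow>
            (\<forall>n\<in>{1..N}. multilinear_rank (2 * N) (paired N J I) (2 * n) A = I n))"
  using rank_U_odd_mode[OF assms(1)] rank_U_even_mode[OF assms(2)] by blast

end
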